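(* Let $0<\mu\le L$, and let $\Phi = f+ g$ with $f \in \mathcal{S}_{\mu,L}^{1}(\mathbb{R}^d)$ and $g \in \mathcal{F}^0(\mathbb{R}^d)$. Let $x^\star$ be the unique minimizer of $\Phi$. For a step size $s>0$ and an arbitrary initial point $x_0=y_0\in\mathbb{R}^d$, let $\{x_k\}_{k=0}^\infty$ and $\{y_k\}_{k=0}^\infty$ be generated by FISTA: for $k\ge 1$, $$x_{k} = y_{k-1} - sG_s(y_{k-1}),\qquad y_{k} = x_{k} + \frac{x_{k} - x_{k-1}}{1+2\sqrt{\mu s}} .$$ (i) If $0 < s \leq 1/L$, then for all $k\ge 0$, $$\Phi(x_{k}) - \Phi(x^\star) \leq \frac{\Phi(x_0) - \Phi(x^\star) + \mu\|x_0 - x^\star\|^2}{\left(1 + \frac{\sqrt{\mu s}}{4}\right)^k}.$$ (ii) If $0 < s < 1/L$, then for all $k\ge 0$, $$\|G_s(y_k)\|^2 \leq \frac{2\left(\Phi(x_0) - \Phi(x^\star) + \mu\|x_0 - x^\star\|^2\right)}{s(1-sL)\left(1 + \frac{\sqrt{\mu s}}{4}\right)^k}.$$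
   Context: $\|\cdot\|$ is the Euclidean norm and $\langle\cdot,\cdot\rangle$ the standard inner product on $\mathbb{R}^d$. $\mathcal{F}^0(\mathbb{R}^d)$ is the class of continuous convex functions $g:\mathbb{R}^d\to\mathbb{R}$. $\mathcal{S}_{\mu,L}^1(\mathbb{R}^d)$ is the class of differentiable functions $f \in \mathcal{F}^0(\mathbb{R}^d)$ that are $L$-smooth, i.e. $\|\nabla f(x) - \nabla f(y)\| \leq L \|x - y\|$ for all $x,y\in\mathbb{R}^d$, and $\mu$-strongly convex, i.e. $f(y) \geq f(x) + \langle \nabla f(x), y - x \rangle + \frac{\mu}{2} \|y - x\|^2$ for all $x,y\in\mathbb{R}^d$. For $s>0$, the $s$-proximal operator is $$P_s(x) := \arg\min_{y\in\mathbb{R}^d}\left\{ \frac{1}{2s}\left\| y - \left(x - s\nabla f(x)\right) \right\|^2 + g(y) \right\},$$ and the $s$-proximal subgradient operator is $G_s(x) := \frac{x - P_s(x)}{s}$, for $x\in\mathbb{R}^d$. *)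

theory Defs
  imports "HOL-Analysis.Analysis"
begin

definition cont_convex :: "('a::real_inner \<Rightarrow> real) set" where
  "cont_convex = {g. continuous_on UNIV g \<and> convex_on UNIV g}"

text \<open>Meaningful only where \<open>f\<close> is differentiable; unspecified elsewhere.\<close>

definition grad :: "('a::real_inner \<Rightarrow> real) \<Rightarrow> 'a \<Rightarrow> 'a" where
  "grad f x = (THE D. GDERIV f x :> D)"

definition smooth_strongly_convex :: "real \<Rightarrow> real \<Rightarrow> ('a::real_inner \<Rightarrow> real) set" where
  "smooth_strongly_convex \<mu> L = {f. f \<in> cont_convex \<and> (\<forall>x. f differentiable (at x)) \<and>
     (\<forall>x y. norm (grad f x - grad f y) \<le> L * norm (x - y)) \<and>
     (\<forall>x y. f y \<ge> f x + inner (grad f x) (y - x) + \<mu> / 2 * (norm (y - x))\<^sup>2)}"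

definition prox_step ::
    "('a::real_inner \<Rightarrow> real) \<Rightarrow> ('a \<Rightarrow> real) \<Rightarrow> real \<Rightarrow> 'a \<Rightarrow> 'a" where
  "prox_step f g s x =
     (ARG_MIN (\<lambda>y. 1 / (2 * s) * (norm (y - (x - s *\<^sub>R grad f x)))\<^sup>2 + g y) y. True)"

definition prox_subgrad ::
    "('a::real_inner \<Rightarrow> real) \<Rightarrow> ('a \<Rightarrow> real) \<Rightarrow> real \<Rightarrow> 'a \<Rightarrow> 'a" where
  "prox_subgrad f g s x = (x - prox_step f g s x) /\<^sub>R s"

definition the_minimizer :: "('a \<Rightarrow> real) \<Rightarrow> 'a" where
  "the_minimizer F = (THE z. is_arg_min F (\<lambda>_. True) z)"

end

(* With q = sqrt (mu s), D k = y k - x k and U k = q (x k - xstar), the Lyapunov function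
     S k = s (Phi (x k) - Phi xstar) + |U k + D k|^2 / 2 + q |D k|^2
   contracts by 1 + q/4 in every step, with a surplus of (1 - sL)/2 |p|^2, where p = s G (y k).
   The decrease combines the proximal gradient inequality
     s (Phi (x (k+1)) - Phi z) <= (p, y k - z) - (1/2 + (1 - sL)/2) |p|^2 - q^2/2 |y k - z|^2
   at z = x k with weight 1 and at z = xstar with the weight that cancels the term (p, U k);
   what remains is a negative semidefinite quadratic form in p, D k, U k. *)

theory Submission
  imports Defs
begin

section \<open>Existence of minimizers\<close>

text \<open>A convex function falls at most linearly, so the quadratic term keeps \<open>h\<close>
  above \<open>h 0\<close> outside a large ball, and compactness gives a minimum inside. Both the
  composite and the proximal objective have this form.\<close>

lemma coercive_attains_min:
  fixes h g :: "'a::euclidean_space \<Rightarrow> real"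
  assumes h: "continuous_on UNIV h" and g: "continuous_on UNIV g" "convex_on UNIV g"
    and "0 < m" and h_ge: "\<And>z. m * (norm z)\<^sup>2 + g z \<le> h z"
  obtains p where "\<And>z. h p \<le> h z"
proof -
  have "compact (g ` cball 0 1)"
    by (intro compact_continuous_image continuous_on_subset[OF g(1)]) auto
  then obtain K where K: "\<And>z. z \<in> cball 0 1 \<Longrightarrow> \<bar>g z\<bar> \<le> K"
    by (metis bounded_iff compact_imp_bounded imageI real_norm_def)
  then have K0: "\<bar>g 0\<bar> \<le> K" by simp
  have g_ge: "- (2 * K) * norm z \<le> g z" if "1 \<le> norm z" for z
  proof -
    \<comment> \<open>At this parameter the segment from 0 to \<open>z\<close> meets the unit
      sphere, where \<open>g\<close> is at least \<open>- K\<close>; convexity transfers the bound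
      to \<open>z\<close>.\<close>
    let ?t = "1 / norm z"
    have t: "0 < ?t" "?t \<le> 1" using that by (auto simp: divide_simps)
    have "g ((1 - ?t) *\<^sub>R 0 + ?t *\<^sub>R z) \<le> (1 - ?t) * g 0 + ?t * g z"
      using t by (intro convex_onD[OF g(2)]) auto
    moreover have "norm (?t *\<^sub>R z) \<le> 1" using that by auto
    then have "- K \<le> g ((1 - ?t) *\<^sub>R 0 + ?t *\<^sub>R z)"
      using K[of "?t *\<^sub>R z"] by simp
    moreover have "(1 - ?t) * g 0 \<le> (1 - ?t) * K"
      using K0 t by (intro mult_left_mono) auto
    moreover have "(1 - ?t) * K \<le> 1 * K"
      using K0 t by (intro mult_right_mono) auto
    ultimately have "- (2 * K) \<le> ?t * g z" by linarith
    then have "norm z * (- (2 * K)) \<le> norm z * (?t * g z)"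
      by (intro mult_left_mono) auto
    then show ?thesis using that by (simp add: mult.commute split: if_splits)
  qed
  \<comment> \<open>The quotient makes \<open>m * norm z - 2 * K\<close> at least the absolute value
    of \<open>h 0\<close>; the maximum with 1 makes \<open>g_ge\<close> applicable.\<close>
  define r where "r = max 1 ((2 * K + \<bar>h 0\<bar>) / m)"
  have outside: "h 0 \<le> h z" if "r \<le> norm z" for z
  proof -
    have z: "1 \<le> norm z" "(2 * K + \<bar>h 0\<bar>) / m \<le> norm z" using that by (auto simp: r_def)
    have "\<bar>h 0\<bar> \<le> m * norm z - 2 * K"
      using z(2) \<open>0 < m\<close> by (simp add: pos_divide_le_eq mult.commute)
    then have "1 * \<bar>h 0\<bar> \<le> norm z * (m * norm z - 2 * K)"
      using z(1) by (intro mult_mono) auto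
    also have "\<dots> \<le> h z"
      using g_ge[OF z(1)] h_ge[of z] by (simp add: power2_eq_square algebra_simps)
    finally show ?thesis by simp
  qed
  have "0 \<le> r" by (simp add: r_def)
  then have "\<exists>p\<in>cball 0 r. \<forall>z\<in>cball 0 r. h p \<le> h z"
    by (intro continuous_attains_inf continuous_on_subset[OF h]) auto
  then obtain p where p: "\<And>z. z \<in> cball 0 r \<Longrightarrow> h p \<le> h z"
    by blast
  have "h p \<le> h z" for z
    using p[of z] p[of 0] outside[of z] \<open>0 \<le> r\<close> by fastforce
  then show thesis by (rule that)
qed

section \<open>Gradients and smoothness\<close>

text \<open>As \<open>grad\<close> is a definite description, existence and uniqueness are both
  required. The Riesz representer of the derivative \<open>f'\<close> is
  \<open>adjoint f' 1\<close>.\<close>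

lemma differentiable_imp_gderiv_grad:
  fixes f :: "'a::euclidean_space \<Rightarrow> real"
  assumes "f differentiable (at x)"
  shows "GDERIV f x :> grad f x"
proof -
  obtain f' where f': "(f has_derivative f') (at x)"
    using assms by (auto simp: differentiable_def)
  then have "linear f'" by (rule has_derivative_linear)
  then have "f' = (\<lambda>h. inner h (adjoint f' 1))"
    by (simp add: fun_eq_iff adjoint_works)
  then have "GDERIV f x :> adjoint f' 1"
    using f' by (simp add: gderiv_def)
  moreover have "D = E" if "GDERIV f x :> D" "GDERIV f x :> E" for D E
    using has_derivative_unique[OF that[unfolded gderiv_def]]
    by (metis inner_commute vector_eq_ldot)
  ultimately show ?thesis unfolding grad_def by (metis (no_types, lifting) theI)
qed

text \<open>The descent lemma: along the segment from \<open>x\<close> to \<open>z\<close>, the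
  difference \<phi> of the two sides has nonpositive derivative, by Cauchy-Schwarz and the Lipschitz
  gradient.\<close>

lemma smooth_upper_bound:
  fixes f :: "'a::euclidean_space \<Rightarrow> real"
  assumes f: "f \<in> smooth_strongly_convex \<mu> L"
  shows "f z \<le> f x + inner (grad f x) (z - x) + L / 2 * (norm (z - x))\<^sup>2"
proof -
  define d where "d = z - x"
  define \<phi> where "\<phi> t = f (x + t *\<^sub>R d) - t * inner (grad f x) d - L / 2 * t\<^sup>2 * (norm d)\<^sup>2" for t
  have "\<phi> 1 \<le> \<phi> 0"
  proof (rule DERIV_nonpos_imp_nonincreasing[where f = \<phi>])
    fix t :: real assume t: "0 \<le> t" "t \<le> 1"
    let ?y = "x + t *\<^sub>R d"
    have "GDERIV f ?y :> grad f ?y"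
      using f by (intro differentiable_imp_gderiv_grad) (simp add: smooth_strongly_convex_def)
    then have f': "(f has_derivative (\<lambda>h. inner h (grad f ?y))) (at ?y)"
      by (simp add: gderiv_def)
    have "((\<lambda>t. x + t *\<^sub>R d) has_derivative (\<lambda>h. h *\<^sub>R d)) (at t)"
      by (auto intro!: derivative_eq_intros)
    from diff_chain_at[OF this f']
    have "((\<lambda>t. f (x + t *\<^sub>R d)) has_real_derivative inner d (grad f ?y)) (at t)"
      by (simp add: has_field_derivative_def o_def mult_commute_abs)
    then have "(\<phi> has_real_derivative
        inner d (grad f ?y) - inner (grad f x) d - L * t * (norm d)\<^sup>2) (at t)"
      unfolding \<phi>_def by (auto intro!: derivative_eq_intros)
    moreover have "inner d (grad f ?y) - inner (grad f x) d \<le> L * t * (norm d)\<^sup>2"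
    proof -
      have "inner d (grad f ?y) - inner (grad f x) d = inner d (grad f ?y - grad f x)"
        by (simp add: inner_diff_right inner_commute)
      also have "\<dots> \<le> norm d * norm (grad f ?y - grad f x)" by (rule norm_cauchy_schwarz)
      also have "\<dots> \<le> norm d * (L * norm (?y - x))"
        using f unfolding smooth_strongly_convex_def by (blast intro: mult_left_mono norm_ge_zero)
      also have "\<dots> = L * t * (norm d)\<^sup>2"
        using t by (simp add: power2_eq_square)
      finally show ?thesis .
    qed
    ultimately show "\<exists>y. (\<phi> has_real_derivative y) (at t) \<and> y \<le> 0" by force
  qed simp
  then show ?thesis by (simp add: \<phi>_def d_def)
qed

section \<open>The minimizer of the composite objective\<close>

text \<open>Strong convexity at 0 gives coercivity, hence existence; strong convexity at a midpoint
  gives the uniqueness that the description in \<open>the_minimizer\<close> demands.\<close>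

lemma the_minimizer_composite:
  fixes f g :: "'a::euclidean_space \<Rightarrow> real"
  assumes f: "f \<in> smooth_strongly_convex \<mu> L" and "0 < \<mu>" and g: "g \<in> cont_convex"
  defines "F \<equiv> \<lambda>z. f z + g z"
  shows "F (the_minimizer F) \<le> F z"
proof -
  have cont: "continuous_on UNIV f" "continuous_on UNIV g" and conv: "convex_on UNIV g"
    using f g by (auto simp: smooth_strongly_convex_def cont_convex_def)
  have sc: "f y + inner (grad f y) (w - y) + \<mu> / 2 * (norm (w - y))\<^sup>2 \<le> f w" for y w
    using f unfolding smooth_strongly_convex_def by blast
  obtain p where p: "\<And>z. F p \<le> F z"
  proof (rule coercive_attains_min[of F "\<lambda>z. (f 0 + inner (grad f 0) z) + g z" "\<mu> / 2"])
    show "continuous_on UNIV F" "continuous_on UNIV (\<lambda>z. (f 0 + inner (grad f 0) z) + g z)"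
      unfolding F_def by (intro continuous_intros cont)+
    have "convex_on UNIV (\<lambda>z. f 0 + inner (grad f 0) z)"
      by (intro convex_onI) (auto simp: inner_add_right algebra_simps)
    then show "convex_on UNIV (\<lambda>z. (f 0 + inner (grad f 0) z) + g z)"
      using conv by (rule convex_on_add)
    show "\<mu> / 2 * (norm z)\<^sup>2 + (f 0 + inner (grad f 0) z + g z) \<le> F z" for z
      using sc[of 0 z] by (simp add: F_def)
  qed (use \<open>0 < \<mu>\<close> in auto)
  have unique: "w = p" if w: "\<And>z. F w \<le> F z" for w
  proof -
    define c where "c = (1 - 1 / 2) *\<^sub>R p + (1 / 2) *\<^sub>R w"
    have c: "w - c = (1 / 2) *\<^sub>R (w - p)" "p - c = - ((1 / 2) *\<^sub>R (w - p))"
      by (simp_all add: c_def algebra_simps flip: scaleR_left_distrib)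
    have "g c \<le> (1 - 1 / 2) * g p + (1 / 2) * g w"
      unfolding c_def by (intro convex_onD[OF conv]) auto
    \<comment> \<open>The two strong convexity bounds at the midpoint are added; their gradient
      terms cancel because \<open>p - c\<close> and \<open>w - c\<close> are opposite.\<close>
    moreover have "2 * f c + \<mu> * (norm ((1 / 2) *\<^sub>R (w - p)))\<^sup>2 \<le> f p + f w"
      using sc[of c p] sc[of c w] unfolding c by simp
    moreover have "F w \<le> F c" "F p \<le> F c" using w p by auto
    ultimately have "\<mu> * (norm ((1 / 2) *\<^sub>R (w - p)))\<^sup>2 \<le> 0" by (simp add: F_def)
    then show ?thesis using \<open>0 < \<mu>\<close> by (simp add: mult_le_0_iff)
  qed
  have "the_minimizer F = p"
    unfolding the_minimizer_def is_arg_min_linorder using p unique by (intro the_equality) auto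
  then show ?thesis using p by simp
qed

section \<open>The proximal step\<close>

text \<open>\<open>ARG_MIN\<close> picks some minimizer as soon as one exists. Existence follows
  from coercivity, with the affine part \<open>l\<close> of the expanded square absorbed into the
  convex function.\<close>

lemma prox_step_minimizes:
  fixes f g :: "'a::euclidean_space \<Rightarrow> real"
  assumes g: "g \<in> cont_convex" and "0 < s"
  defines "a \<equiv> \<lambda>x. x - s *\<^sub>R grad f x"
  shows "1 / (2 * s) * (norm (prox_step f g s x - a x))\<^sup>2 + g (prox_step f g s x)
    \<le> 1 / (2 * s) * (norm (z - a x))\<^sup>2 + g z"
proof -
  define h where "h = (\<lambda>z. 1 / (2 * s) * (norm (z - a x))\<^sup>2 + g z)"
  define l where "l z = 1 / (2 * s) * (norm (a x))\<^sup>2 + inner ((- 1 / s) *\<^sub>R a x) z" for z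
  have cont: "continuous_on UNIV g" and conv: "convex_on UNIV g"
    using g by (auto simp: cont_convex_def)
  obtain p where p: "\<And>z. h p \<le> h z"
  proof (rule coercive_attains_min[of h "\<lambda>z. l z + g z" "1 / (2 * s)"])
    show "continuous_on UNIV h" "continuous_on UNIV (\<lambda>z. l z + g z)"
      unfolding h_def l_def by (intro continuous_intros cont)+
    have "convex_on UNIV l"
      unfolding l_def by (intro convex_onI)
        (auto simp: inner_add_right algebra_simps simp flip: add_divide_distrib)
    then show "convex_on UNIV (\<lambda>z. l z + g z)"
      using conv by (rule convex_on_add)
    have sq: "(norm (z - a x))\<^sup>2 = (norm z)\<^sup>2 + (norm (a x))\<^sup>2 - 2 * inner (a x) z" for z
      unfolding power2_norm_eq_inner by (simp add: algebra_simps inner_commute)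
    show "1 / (2 * s) * (norm z)\<^sup>2 + (l z + g z) \<le> h z" for z
      using \<open>0 < s\<close> by (simp add: h_def l_def sq divide_simps)
  qed (use \<open>0 < s\<close> in auto)
  have "h (arg_min h (\<lambda>_. True)) \<le> h z"
    by (rule arg_minI[of "\<lambda>_. True" p]) (auto simp: p not_less intro: order_trans)
  then show ?thesis unfolding h_def prox_step_def a_def .
qed

text \<open>First-order optimality of the proximal point, and the only property of
  \<open>prox_step\<close> that the later estimates rest on.\<close>

lemma prox_step_subgradient:
  fixes f g :: "'a::euclidean_space \<Rightarrow> real" and x z :: 'a
  assumes g: "g \<in> cont_convex" and "0 < s"
  defines "P \<equiv> prox_step f g s x"
  shows "g P + inner (x - s *\<^sub>R grad f x - P) (z - P) / s \<le> g z"
proof -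
  define a where "a = x - s *\<^sub>R grad f x"
  define v where "v = inner (a - P) (z - P)"
  \<comment> \<open>\<open>c\<close> measures the violation of the subgradient inequality;
    \<open>N\<close> is the second-order coefficient of the proximal objective along the
    segment.\<close>
  define c where "c = v / s - (g z - g P)"
  define N where "N = (norm (z - P))\<^sup>2 / (2 * s)"
  have conv: "convex_on UNIV g" using g by (simp add: cont_convex_def)
  \<comment> \<open>Compare \<open>P\<close> with the point at parameter \<open>t\<close> of the segment to \<open>z\<close>, and let \<open>t\<close> tend to 0.\<close>
  have bound: "c \<le> t * N" if t: "0 < t" "t \<le> 1" for t
  proof -
    let ?y = "(1 - t) *\<^sub>R P + t *\<^sub>R z"
    have y: "?y - a = (P - a) + t *\<^sub>R (z - P)" by (simp add: algebra_simps)
    have "(norm (?y - a))\<^sup>2 = (norm (P - a))\<^sup>2 - 2 * t * v + t\<^sup>2 * (norm (z - P))\<^sup>2"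
      unfolding y v_def power2_norm_eq_inner
      by (simp add: algebra_simps inner_commute power2_eq_square)
    moreover have "1 / (2 * s) * (norm (P - a))\<^sup>2 + g P \<le> 1 / (2 * s) * (norm (?y - a))\<^sup>2 + g ?y"
      unfolding P_def a_def by (rule prox_step_minimizes[OF g \<open>0 < s\<close>])
    moreover have "g ?y \<le> (1 - t) * g P + t * g z"
      using t by (intro convex_onD[OF conv]) auto
    ultimately have "1 / (2 * s) * (norm (P - a))\<^sup>2 + g P \<le> 1 / (2 * s) *
        ((norm (P - a))\<^sup>2 - 2 * t * v + t\<^sup>2 * (norm (z - P))\<^sup>2) + ((1 - t) * g P + t * g z)"
      by simp
    then have "t * c \<le> t * (t * N)"
      using \<open>0 < s\<close> by (simp add: c_def N_def field_simps power2_eq_square)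
    then show ?thesis using t by simp
  qed
  have "c \<le> 0"
  proof (rule tendsto_lowerbound)
    show "((\<lambda>t. t * N) \<longlongrightarrow> 0) (at_right 0)"
      by (auto intro!: tendsto_eq_intros)
    show "\<forall>\<^sub>F t in at_right 0. c \<le> t * N"
      using bound by (auto simp: eventually_at_right_field intro!: exI[of _ 1])
  qed simp
  then show ?thesis by (simp add: c_def a_def v_def)
qed

text \<open>Adds the descent lemma at \<open>P\<close>, strong convexity between \<open>y\<close>
  and \<open>z\<close>, and the subgradient inequality. The coefficient \<open>1 - s * L / 2\<close>
  is split so that the part vanishing at \<open>s = 1 / L\<close> stands alone.\<close>

lemma prox_gradient_inequality:
  fixes f g :: "'a::euclidean_space \<Rightarrow> real" and y z :: 'a
  assumes f: "f \<in> smooth_strongly_convex \<mu> L" and g: "g \<in> cont_convex" and "0 < s"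
  defines "P \<equiv> prox_step f g s y"
  shows "s * ((f P + g P) - (f z + g z)) \<le> inner (y - P) (y - z)
    - (1 / 2 + (1 - s * L) / 2) * (norm (y - P))\<^sup>2 - s * \<mu> / 2 * (norm (y - z))\<^sup>2"
proof -
  let ?n = "grad f y"
  define v where "v = inner (y - s *\<^sub>R ?n - P) (z - P)"
  have "f P \<le> f y + inner ?n (P - y) + L / 2 * (norm (y - P))\<^sup>2"
    using smooth_upper_bound[OF f] by (simp add: norm_minus_commute)
  moreover have "f y + inner ?n (z - y) + \<mu> / 2 * (norm (y - z))\<^sup>2 \<le> f z"
    using f unfolding smooth_strongly_convex_def by (simp add: norm_minus_commute)
  moreover have "g P - g z \<le> - v / s"
    using prox_step_subgradient[OF g \<open>0 < s\<close>, of f y z] unfolding P_def v_def by simp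
  ultimately have "(f P + g P) - (f z + g z) \<le> inner ?n (P - y) + L / 2 * (norm (y - P))\<^sup>2
      - inner ?n (z - y) - \<mu> / 2 * (norm (y - z))\<^sup>2 - v / s"
    by linarith
  then have "s * ((f P + g P) - (f z + g z)) \<le> s * (inner ?n (P - y) + L / 2 * (norm (y - P))\<^sup>2
      - inner ?n (z - y) - \<mu> / 2 * (norm (y - z))\<^sup>2 - v / s)"
    using \<open>0 < s\<close> by (intro mult_left_mono) auto
  also have "\<dots> = s * inner ?n (P - z) - v
      + s * L / 2 * (norm (y - P))\<^sup>2 - s * \<mu> / 2 * (norm (y - z))\<^sup>2"
    using \<open>0 < s\<close> by (simp add: algebra_simps)
  \<comment> \<open>The gradient in \<open>v\<close> cancels the explicit gradient term, and
    \<open>P - z\<close> is split as \<open>(y - z) - (y - P)\<close>.\<close>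
  also have "s * inner ?n (P - z) - v
      = inner (y - P) (y - z) - (norm (y - P))\<^sup>2"
    unfolding power2_norm_eq_inner v_def by (simp add: algebra_simps inner_commute)
  finally show ?thesis by (simp add: algebra_simps diff_divide_distrib add_divide_distrib)
qed

section \<open>The Lyapunov inequality\<close>

text \<open>These are the sign conditions that make the quadratic form \<open>Q\<close> of
  \<open>lyapunov_step\<close> nonpositive. There \<open>r\<close> is the coefficient of
  \<open>D - p\<close> in \<open>U' + D'\<close>, \<open>m\<close> is the contraction factor, and
  \<open>- q * T\<close> is the coefficient of the cross term of \<open>D\<close> and
  \<open>U\<close>.\<close>

lemma lyapunov_coefficients:
  fixes q :: real
  defines "r \<equiv> q + 1 / (1 + 2 * q)" and "m \<equiv> 1 + q / 4"
  assumes "0 < q" "q \<le> 1"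
  obtains T where "1 - r * m * (1 - q\<^sup>2) = q * T" "0 \<le> T" "T \<le> 1" "T \<le> r * m - 1 / 4"
    and "m * (r\<^sup>2 / 2 + q * (1 / (1 + 2 * q))\<^sup>2) \<le> 1 / 2 + q * (r * m) / 2"
proof
  let ?T = "(3 - 5 * q + 3 * q^2 + 9 * q^3 + 2 * q^4) / (4 * (1 + 2 * q))"
  have r: "r = (1 + q + 2 * q\<^sup>2) / (1 + 2 * q)"
    unfolding r_def using assms by (simp add: field_simps power2_eq_square)
  have pw: "q^2 \<le> q" "q^3 \<le> q^2" "q^4 \<le> q^3" "0 \<le> q^2" "0 \<le> q^3" "0 \<le> q^4"
    using assms by (auto simp: power_le_one_iff numeral_eq_Suc mult_le_one mult_left_le)
  have rm: "r * m = (4 + 5 * q + 9 * q^2 + 2 * q^3) / (4 * (1 + 2 * q))"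
    unfolding r m_def using assms by (simp add: divide_simps) (simp add: algebra_simps power_numeral_reduce)
  show "1 - r * m * (1 - q\<^sup>2) = q * ?T"
    unfolding rm using assms by (simp add: divide_simps) (simp add: algebra_simps power_numeral_reduce)
  \<comment> \<open>Completes the square in \<open>3 - 5 * q + 3 * q^2\<close>, whose vertex is at
    5/6.\<close>
  have "0 \<le> (q - 5 / 6)\<^sup>2" by simp
  then have "0 \<le> 3 - 5 * q + 3 * q^2" by (simp add: power2_eq_square algebra_simps)
  then show "0 \<le> ?T" using assms pw by (intro divide_nonneg_nonneg) auto
  show "?T \<le> 1" using assms pw by (simp add: divide_simps)
  show "?T \<le> r * m - 1 / 4"
  proof -
    have "?T \<le> (3 + 3 * q + 9 * q^2 + 2 * q^3) / (4 * (1 + 2 * q))"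
      using assms pw by (intro divide_right_mono) (linarith | simp)+
    also have "\<dots> = r * m - 1 / 4"
      unfolding rm using assms by (simp add: divide_simps) (simp add: algebra_simps)
    finally show ?thesis .
  qed
  have "1 / 2 + q * (r * m) / 2 - m * (r\<^sup>2 / 2 + q * (1 / (1 + 2 * q))\<^sup>2) =
      (3 / 4 * q + 5 / 4 * q^2 - q^3 / 2) / (2 * (1 + 2 * q)\<^sup>2)"
    unfolding r m_def using assms
    by (simp add: divide_simps) (simp add: algebra_simps power_numeral_reduce)
  also have "\<dots> \<ge> 0" using assms pw by (intro divide_nonneg_nonneg) (linarith | simp)+
  finally show "m * (r\<^sup>2 / 2 + q * (1 / (1 + 2 * q))\<^sup>2) \<le> 1 / 2 + q * (r * m) / 2" by simp
qed

text \<open>One iteration in pure inner product form: \<open>e\<close> and \<open>e'\<close> stand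
  for the scaled objective gaps, \<open>dec\<close> and \<open>gap\<close> for the proximal
  inequality at the current iterate and, scaled by \<open>q\<close>, at the minimizer.\<close>

lemma lyapunov_step:
  fixes p D U :: "'a::real_inner" and q e e' \<eta> :: real
  defines "b \<equiv> 1 / (1 + 2 * q)"
  defines "D' \<equiv> b *\<^sub>R (D - p)" and "U' \<equiv> U + q *\<^sub>R (D - p)"
  assumes q: "0 < q" "q \<le> 1" and "0 \<le> e'" "0 \<le> \<eta>"
    and dec: "e' - e \<le> inner p D - (1 / 2 + \<eta>) * (norm p)\<^sup>2 - q\<^sup>2 / 2 * (norm D)\<^sup>2"
    and gap: "q * e' \<le> inner p (U + q *\<^sub>R D) - q * (1 / 2 + \<eta>) * (norm p)\<^sup>2
                - q / 2 * (norm (U + q *\<^sub>R D))\<^sup>2"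
  shows "(1 + q / 4) * (e' + (norm (U' + D'))\<^sup>2 / 2 + q * (norm D')\<^sup>2) + \<eta> * (norm p)\<^sup>2
    \<le> e + (norm (U + D))\<^sup>2 / 2 + q * (norm D)\<^sup>2"
proof -
  define r m M where "r = q + b" and "m = 1 + q / 4" and "M = r * m"
  obtain T where T: "1 - M * (1 - q\<^sup>2) = q * T" "0 \<le> T" "T \<le> 1" "T \<le> M - 1 / 4"
    and s: "m * (r\<^sup>2 / 2 + q * b\<^sup>2) \<le> 1 / 2 + q * M / 2"
    using lyapunov_coefficients[OF q] unfolding r_def m_def M_def b_def by metis
  \<comment> \<open>With this slack all terms in \<open>p\<close> not involving \<eta> combine with
    part of those in \<open>D\<close> into a multiple of \<open>(norm (D - p))\<^sup>2\<close>; the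
    weight \<open>M = r * m\<close> has already removed \<open>inner p U\<close>.\<close>
  define \<sigma> where "\<sigma> = 1 / 2 + q * M / 2 - m * (r\<^sup>2 / 2 + q * b\<^sup>2)"
  have "0 \<le> \<sigma>" using s by (simp add: \<sigma>_def)
  \<comment> \<open>What is left after adding \<open>dec\<close> and \<open>M\<close> times \<open>gap\<close>, as a negative combination of squares.\<close>
  define Q where "Q = - (\<sigma> * (norm (D - p))\<^sup>2) - q * T / 2 * (norm (U + D))\<^sup>2
    - q / 2 * (M - 1 / 4 - T) * (norm U)\<^sup>2 - q / 2 * (1 + q + q * T - T) * (norm D)\<^sup>2"
  have "0 \<le> q * T" using q T by simp
  then have "Q \<le> 0"
    unfolding Q_def using q T \<open>0 \<le> \<sigma>\<close>
    by (smt (verit) mult_nonneg_nonneg zero_le_power2 divide_nonneg_nonneg)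
  have "M * (q * e') \<le> M * (inner p (U + q *\<^sub>R D) - q * (1 / 2 + \<eta>) * (norm p)\<^sup>2
                - q / 2 * (norm (U + q *\<^sub>R D))\<^sup>2)"
    using gap T by (intro mult_left_mono) auto
  moreover have UD': "U' + D' = U + r *\<^sub>R (D - p)"
    by (simp add: U'_def D'_def r_def algebra_simps)
  moreover have "inner p D - (1 / 2 + \<eta>) * (norm p)\<^sup>2 - q\<^sup>2 / 2 * (norm D)\<^sup>2
      + M * (inner p (U + q *\<^sub>R D) - q * (1 / 2 + \<eta>) * (norm p)\<^sup>2
                - q / 2 * (norm (U + q *\<^sub>R D))\<^sup>2)
      + m * ((norm (U + r *\<^sub>R (D - p)))\<^sup>2 / 2 + q * (norm D')\<^sup>2)
      - (norm (U + D))\<^sup>2 / 2 - q * (norm D)\<^sup>2 = Q - \<eta> * (1 + q * M) * (norm p)\<^sup>2"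
  proof -
    define pp pD pU DD DU UU where "pp = inner p p" and "pD = inner p D" and "pU = inner p U"
      and "DD = inner D D" and "DU = inner D U" and "UU = inner U U"
    have n: "(norm p)\<^sup>2 = pp" "(norm D)\<^sup>2 = DD" "(norm U)\<^sup>2 = UU" "inner p D = pD"
      "(norm (U + D))\<^sup>2 = UU + 2 * DU + DD"
      "(norm (D - p))\<^sup>2 = DD - 2 * pD + pp"
      "inner p (U + q *\<^sub>R D) = pU + q * pD"
      "(norm (U + q *\<^sub>R D))\<^sup>2 = UU + 2 * q * DU + q\<^sup>2 * DD"
      "(norm (U + r *\<^sub>R (D - p)))\<^sup>2 = UU + 2 * r * (DU - pU) + r\<^sup>2 * (DD - 2 * pD + pp)"
      "(norm D')\<^sup>2 = b\<^sup>2 * (DD - 2 * pD + pp)"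
      unfolding pp_def pD_def pU_def DD_def DU_def UU_def D'_def power2_norm_eq_inner
      by (simp_all add: inner_commute power2_eq_square algebra_simps)
    have "m * ((UU + 2 * r * (DU - pU) + r\<^sup>2 * (DD - 2 * pD + pp)) / 2 + q * (b\<^sup>2 * (DD - 2 * pD + pp)))
        = m * UU / 2 + r * m * (DU - pU) + m * (r\<^sup>2 / 2 + q * b\<^sup>2) * (DD - 2 * pD + pp)"
      by (simp add: field_simps)
    also have "\<dots> = (1 + q / 4) * UU / 2 + M * (DU - pU) + (1 / 2 + q * M / 2 - \<sigma>) * (DD - 2 * pD + pp)"
      by (simp add: \<sigma>_def M_def m_def)
    finally have m: "m * ((UU + 2 * r * (DU - pU) + r\<^sup>2 * (DD - 2 * pD + pp)) / 2
        + q * (b\<^sup>2 * (DD - 2 * pD + pp))) = \<dots>" .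
    \<comment> \<open>In this form \<open>T\<close> occurs only in the product \<open>q * T\<close>,
      which its defining relation replaces by an expression in \<open>M\<close> and
      \<open>q\<close>.\<close>
    have "Q = - \<sigma> * (DD - 2 * pD + pp) - q * T / 2 * (UU + 2 * DU + DD)
        - (q / 2 * (M - 1 / 4) - q * T / 2) * UU
        - (q / 2 * (1 + q) + q * (q * T) / 2 - q * T / 2) * DD"
      unfolding Q_def n by (simp add: field_simps)
    then show ?thesis
      unfolding n m T(1)[symmetric] by (simp add: field_simps power2_eq_square)
  qed
  \<comment> \<open>The sum carries \<open>(1 + q * M) * e'\<close>, whereas only
    \<open>(1 + q / 4) * e'\<close> is claimed; the excess is dropped, as is the additional \<eta>
    term.\<close>
  moreover have "0 \<le> (q * (M - 1 / 4)) * e'" "0 \<le> \<eta> * (q * M) * (norm p)\<^sup>2"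
    using T q \<open>0 \<le> e'\<close> \<open>0 \<le> \<eta>\<close> by auto
  ultimately show ?thesis
    using dec \<open>Q \<le> 0\<close> unfolding m_def UD' by (simp add: field_simps)
qed

section \<open>Convergence rates of FISTA\<close>

theorem theorem5p1:
  fixes f g \<Phi> :: "real ^ 'd \<Rightarrow> real"
    and x y :: "nat \<Rightarrow> real ^ 'd"
    and xstar :: "real ^ 'd"
    and \<mu> L s :: real
  assumes "0 < \<mu>" and "\<mu> \<le> L"
    and "f \<in> smooth_strongly_convex \<mu> L"
    and "g \<in> cont_convex"
    and "\<Phi> = (\<lambda>z. f z + g z)"
    and "xstar = the_minimizer \<Phi>"
    and "0 < s"
    and "x 0 = y 0"
    and "\<And>k. k \<ge> 1 \<Longrightarrow> x k = y (k - 1) - s *\<^sub>R prox_subgrad f g s (y (k - 1))"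
    and "\<And>k. k \<ge> 1 \<Longrightarrow> y k = x k + (x k - x (k - 1)) /\<^sub>R (1 + 2 * sqrt (\<mu> * s))"
  shows "(s \<le> 1 / L \<longrightarrow>
           (\<forall>k. \<Phi> (x k) - \<Phi> xstar
              \<le> (\<Phi> (x 0) - \<Phi> xstar + \<mu> * (norm (x 0 - xstar))\<^sup>2)
                / (1 + sqrt (\<mu> * s) / 4) ^ k))
       \<and> (s < 1 / L \<longrightarrow>
           (\<forall>k. (norm (prox_subgrad f g s (y k)))\<^sup>2
              \<le> 2 * (\<Phi> (x 0) - \<Phi> xstar + \<mu> * (norm (x 0 - xstar))\<^sup>2)
                / (s * (1 - s * L) * (1 + sqrt (\<mu> * s) / 4) ^ k)))"
proof -
  define q b where "q = sqrt (\<mu> * s)" and "b = 1 / (1 + 2 * q)"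
  define S0 where "S0 = \<Phi> (x 0) - \<Phi> xstar + \<mu> * (norm (x 0 - xstar))\<^sup>2"
  define p D U e \<eta>
    where "p k = s *\<^sub>R prox_subgrad f g s (y k)" and "D k = y k - x k"
      and "U k = q *\<^sub>R (x k - xstar)" and "e k = s * (\<Phi> (x k) - \<Phi> xstar)"
      and "\<eta> = (1 - s * L) / 2" for k
  define S where "S k = e k + (norm (U k + D k))\<^sup>2 / 2 + q * (norm (D k))\<^sup>2" for k
  have q: "0 < q" "q\<^sup>2 = s * \<mu>"
    using assms by (simp_all add: q_def mult.commute)
  have star: "\<Phi> xstar \<le> \<Phi> z" for z
    using the_minimizer_composite[OF assms(3,1,4)] assms(5,6) by simp
  then have e_nonneg: "0 \<le> e k" for k
    using \<open>0 < s\<close> by (simp add: e_def)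
  have p: "p k = y k - prox_step f g s (y k)" for k
    using \<open>0 < s\<close> by (simp add: p_def prox_subgrad_def)
  have x_Suc: "x (Suc k) = y k - p k" for k
    using assms(9)[of "Suc k"] by (simp add: p_def)
  then have prox: "prox_step f g s (y k) = x (Suc k)" for k
    by (simp add: p)
  have diff: "x (Suc k) - x k = D k - p k" for k
    by (simp add: x_Suc D_def)
  have D_Suc: "D (Suc k) = b *\<^sub>R (D k - p k)" for k
    using assms(10)[of "Suc k"] unfolding diff[symmetric]
    by (simp add: D_def b_def q_def inverse_eq_divide)
  have U_Suc: "U (Suc k) = U k + q *\<^sub>R (D k - p k)" for k
    unfolding diff[symmetric] by (simp add: U_def algebra_simps)
  have ineq: "s * (\<Phi> (x (Suc k)) - \<Phi> z) \<le> inner (p k) (y k - z)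
      - (1 / 2 + \<eta>) * (norm (p k))\<^sup>2 - q\<^sup>2 / 2 * (norm (y k - z))\<^sup>2" for k z
    using prox_gradient_inequality[OF assms(3,4) \<open>0 < s\<close>, of "y k" z]
    by (simp add: prox x_Suc assms(5) \<eta>_def q(2))
  have step: "(1 + q / 4) * S (Suc k) + \<eta> * (norm (p k))\<^sup>2 \<le> S k" if "s \<le> 1 / L" for k
  proof -
    have sL: "s * L \<le> 1" using that assms by (simp add: pos_le_divide_eq)
    moreover have "s * \<mu> \<le> s * L" using assms by simp
    ultimately have "q\<^sup>2 \<le> 1\<^sup>2" using q(2) by simp
    then have "q \<le> 1" by (rule power2_le_imp_le) simp
    have UD: "U k + q *\<^sub>R D k = q *\<^sub>R (y k - xstar)"
      by (simp add: U_def D_def algebra_simps)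
    have "e (Suc k) - e k \<le> inner (p k) (D k)
      - (1 / 2 + \<eta>) * (norm (p k))\<^sup>2 - q\<^sup>2 / 2 * (norm (D k))\<^sup>2"
      using ineq[of k "x k"] by (simp add: e_def D_def algebra_simps)
    \<comment> \<open>Multiplying \<open>ineq\<close> at \<open>xstar\<close> by \<open>q\<close>
      turns \<open>y k - xstar\<close> into \<open>U k + q *\<^sub>R D k\<close>; in the last term
      two of the three factors \<open>q\<close> go into the norm.\<close>
    moreover have "q * e (Suc k) \<le> inner (p k) (U k + q *\<^sub>R D k)
      - q * (1 / 2 + \<eta>) * (norm (p k))\<^sup>2 - q / 2 * (norm (U k + q *\<^sub>R D k))\<^sup>2"
      using mult_left_mono[OF ineq[of k xstar], of q] q(1)
      unfolding UD by (simp add: e_def power_mult_distrib right_diff_distrib)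
    ultimately show ?thesis
      using lyapunov_step[OF q(1) \<open>q \<le> 1\<close> e_nonneg, of \<eta> "Suc k" "e k" "p k" "D k" "U k"] sL
      by (simp add: S_def D_Suc U_Suc b_def \<eta>_def)
  qed
  have pos: "0 < 1 + q / 4" using q(1) by simp
  have S_bound: "S k \<le> s * S0 / (1 + q / 4) ^ k" if sL: "s \<le> 1 / L" for k
  proof (induction k)
    case 0
    \<comment> \<open>\<open>D 0\<close> vanishes since \<open>x 0 = y 0\<close>. As
      \<open>q\<^sup>2 = s * \<mu>\<close>, the bound by \<open>s * S0\<close> gives away a factor
      of two in the distance term.\<close>
    have "S 0 = e 0 + q\<^sup>2 / 2 * (norm (x 0 - xstar))\<^sup>2"
      by (simp add: S_def D_def U_def assms(8) power_mult_distrib)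
    also have "\<dots> \<le> s * S0"
      using \<open>0 < s\<close> \<open>0 < \<mu>\<close> by (simp add: e_def S0_def q(2) algebra_simps)
    finally show ?case by simp
  next
    case (Suc k)
    have "0 \<le> \<eta>" using sL assms by (simp add: \<eta>_def pos_le_divide_eq)
    then have "(1 + q / 4) * S (Suc k) \<le> s * S0 / (1 + q / 4) ^ k"
      using step[OF sL, of k] Suc zero_le_power2[of "norm (p k)"]
      by (smt (verit) mult_nonneg_nonneg)
    then show ?case
      using pos by (simp add: pos_le_divide_eq mult_ac flip: divide_divide_eq_left)
  qed
  have S_nonneg: "0 \<le> S k" and e_le: "e k \<le> S k" for k
    using e_nonneg[of k] q(1) by (simp_all add: S_def)
  have "\<Phi> (x k) - \<Phi> xstar \<le> S0 / (1 + q / 4) ^ k" if sL: "s \<le> 1 / L" for k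
    using order_trans[OF e_le S_bound[OF sL]] \<open>0 < s\<close>
    by (simp add: e_def flip: times_divide_eq_right)
  moreover have "(norm (prox_subgrad f g s (y k)))\<^sup>2
      \<le> 2 * S0 / (s * (1 - s * L) * (1 + q / 4) ^ k)" if sL: "s < 1 / L" for k
  proof -
    have "0 < 1 - s * L" using sL assms by (simp add: pos_less_divide_eq)
    \<comment> \<open>Here the surplus of \<open>step\<close> is kept and the nonnegative
      \<open>S (Suc k)\<close> is dropped, so the rate for the subgradient has exponent
      \<open>k\<close>.\<close>
    have "\<eta> * (norm (p k))\<^sup>2 \<le> S k"
      using step[of k] S_nonneg[of "Suc k"] pos sL by (smt (verit) mult_nonneg_nonneg)
    also have "\<dots> \<le> s * S0 / (1 + q / 4) ^ k" using S_bound sL by simp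
    finally have "s * (s * (1 - s * L) * (norm (prox_subgrad f g s (y k)))\<^sup>2)
        \<le> s * (2 * S0 / (1 + q / 4) ^ k)"
      by (simp add: \<eta>_def p_def power_mult_distrib power2_eq_square mult_ac)
    then have "s * (1 - s * L) * (norm (prox_subgrad f g s (y k)))\<^sup>2 \<le> 2 * S0 / (1 + q / 4) ^ k"
      using \<open>0 < s\<close> by (rule mult_left_le_imp_le)
    then show ?thesis
      using \<open>0 < s\<close> \<open>0 < 1 - s * L\<close> pos
      by (simp add: pos_le_divide_eq mult_ac)
  qed
  ultimately show ?thesis unfolding S0_def q_def by blast
qed

end
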